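(* Let $D=\{z\in\mathbb{C}:|z-1/2|\le1/2\}$ and let $U\subset\mathbb{R}^2=\mathbb{C}$ be a bounded, mildly regular open set with $\operatorname{int}(D)\subset U$, $x>0$ for all $(x,y)\in U$, $\bar U\supset D$, and $0\le x\le1$, $|y|\le1/2$ for all $(x,y)\in\bar U$. Let $\mathcal{B}=I_1:=\{m+n\mathrm{i}:m\in\mathbb{N},n\in\mathbb{Z}\}$ or $\mathcal{B}=I_2:=\{m+n\mathrm{i}:m\in\mathbb{N},n\in\mathbb{Z},n<0\}$, $\theta_b(z)=1/(z+b)$, let $s>1$ and $R>2$, and let $v_s$ be the (unique up to scalar multiples) strictly positive continuous eigenfunction on $\bar U$ of $L_s$, $(L_sf)(z)=\sum_{b\in\mathcal{B}}|z+b|^{-2s}f(\theta_b(z))$. Then for all $z\in\bar U$: $$\sum_{b\in I_1,|b|>R}\frac{v_s(\theta_b(z))}{|z+b|^{2s}}\le\exp\Big(\frac{s}{\sqrt{R^2-R}}\Big)\Big(\frac{R}{R-1}\Big)^s\Big[\frac{1}{2s-1}\Big(\frac{1}{R-1}\Big)^{2s-1}+\frac{\pi}{2}\cdot\frac{1}{s-1}\Big(\frac{1}{R-\sqrt2}\Big)^{2s-2}\Big]v_s(0)$$ when $\mathcal{B}=I_1$, and $$\sum_{b\in I_2,|b|>R}\frac{v_s(\theta_b(z))}{|z+b|^{2s}}\le\exp\Big(\frac{s}{\sqrt{R^2-R}}\Big)\Big(\frac{R}{R-1}\Big)^s\Big[\frac{\pi}{4}\cdot\frac{1}{s-1}\Big(\frac{1}{R-\sqrt2}\Big)^{2s-2}\Big]v_s(0)$$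 when $\mathcal{B}=I_2$.
   Context: A bounded open set $H\subset\mathbb{R}^n$ is mildly regular if there exist $\eta>0$ and $M\ge1$ such that whenever $x,y\in H$ and $\|x-y\|<\eta$, there is a Lipschitz map $\psi:[0,1]\to H$ with $\psi(0)=x$, $\psi(1)=y$ and $\int_0^1\|\psi'(t)\|\,dt\le M\|x-y\|$. $L_s$ acts on continuous functions on $\bar U$; $\mathbb{N}=\{1,2,\dots\}$. *)

theory Defs
  imports "HOL-Analysis.Analysis"
begin

text \<open>Mild regularity (path condition; boundedness and openness are assumed separately).
  The derivative of a Lipschitz path exists almost everywhere; its length is the
  integral of the norm of the vector derivative over [0,1].\<close>
definition mildly_regular :: "'a::euclidean_space set \<Rightarrow> bool" where
  "mildly_regular H \<longleftrightarrow>
     (\<exists>\<eta>>0. \<exists>M\<ge>1. \<forall>x\<in>H. \<forall>y\<in>H. norm (x - y) < \<eta> \<longrightarrow>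
        (\<exists>\<psi> :: real \<Rightarrow> 'a. (\<exists>C. C-lipschitz_on {0..1} \<psi>) \<and> \<psi> ` {0..1} \<subseteq> H \<and>
            \<psi> 0 = x \<and> \<psi> 1 = y \<and>
            (\<lambda>t. norm (vector_derivative \<psi> (at t))) integrable_on {0..1} \<and>
            integral {0..1} (\<lambda>t. norm (vector_derivative \<psi> (at t))) \<le> M * norm (x - y)))"

definition I1 :: "complex set" where
  "I1 = {of_nat m + of_int n * \<i> | m n. m \<ge> 1}"

definition I2 :: "complex set" where
  "I2 = {of_nat m + of_int n * \<i> | m n. m \<ge> 1 \<and> n < 0}"

end

theory Submission
  imports Defs
begin

text \<open>Iterating the eigenvalue equation writes \<open>lam^k v(z)\<close> as a sum over words of length \<open>k\<close>
  of \<open>K |z + \<beta>|^(-2s) v(\<theta>(z))\<close>, where \<open>\<theta>\<close> is the Moebius map of the word and \<open>Re \<beta> \<ge> 1\<close>.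
  Since \<open>ln |z + \<beta>|\<close> does not decrease in \<open>Re z\<close> and is \<open>1/2\<close>-Lipschitz in \<open>Im z\<close>, comparing the terms
  at \<open>w\<close> and at \<open>0\<close> costs a factor of at most \<open>exp(s |w|)\<close>, while \<open>v(\<theta>(w)) / v(\<theta>(0))\<close> tends to \<open>1\<close>
  uniformly because long words contract. Hence \<open>v(w) \<le> exp(s |w|) v(0)\<close>.
  Together with \<open>|z + b|^2 \<ge> |b|^2 - |b|\<close> this reduces the claim to bounding \<open>|b|^(-2s)\<close> summed over
  \<open>|b| > R\<close>: the real axis is compared with a one-dimensional integral, and the other lattice
  points, via the unit squares between them and the origin, with the integral of \<open>|z|^(-2s)\<close> over
  \<open>|z| > R - sqrt 2\<close>.\<close>

section \<open>Growth of the eigenfunction near the origin\<close>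

fun cf_branch :: "complex list \<Rightarrow> complex \<Rightarrow> complex" where
  "cf_branch [] z = z"
| "cf_branch (b # bs) z = cf_branch bs (1 / (z + b))"

text \<open>Since 1/(z + b) has derivative of modulus \<open>norm (z + b) powr (-2)\<close>, the
  chain rule makes this the modulus of the derivative of \<open>cf_branch bs\<close> at z, raised to
  the power s.\<close>

fun cf_weight :: "real \<Rightarrow> complex list \<Rightarrow> complex \<Rightarrow> real" where
  "cf_weight s [] z = 1"
| "cf_weight s (b # bs) z = norm (z + b) powr (- (2 * s)) * cf_weight s bs (1 / (z + b))"

lemma cf_branch_snoc: "cf_branch (bs @ [b]) z = 1 / (cf_branch bs z + b)"
  by (induction bs arbitrary: z) auto

lemma cf_weight_snoc:
  "cf_weight s (bs @ [b]) z = cf_weight s bs z * norm (cf_branch bs z + b) powr (- (2 * s))"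
  by (induction bs arbitrary: z) auto

text \<open>The half-plane consists of points at least as close to 2 as to 0, and the distance from
  1/w to 1/2 is |2 - w| / (2 |w|).\<close>

lemma inverse_mem_disc:
  assumes "Re w \<ge> 1"
  shows "1 / w \<in> cball (1/2) (1/2)"
proof -
  have w0: "w \<noteq> 0" using assms by auto
  have "(norm (2 - w))\<^sup>2 \<le> (norm w)\<^sup>2"
    using assms unfolding cmod_power2 by (simp add: power2_eq_square algebra_simps)
  then have le: "norm (2 - w) \<le> norm w" by (rule power2_le_imp_le) simp
  have "1 / 2 - 1 / w = - (2 - w) / (2 * w)" using w0 by (simp add: field_simps)
  then have "norm (1 / 2 - 1 / w) = norm (2 - w) / (2 * norm w)"
    by (simp add: norm_divide norm_mult norm_minus_commute)
  also have "\<dots> \<le> 1 / 2" using le w0 by (simp add: field_simps)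
  finally show ?thesis by (simp add: dist_norm)
qed

lemma Re_inverse_nonneg:
  assumes "Re w \<ge> 0"
  shows "Re (1 / w) \<ge> 0"
  using assms by (simp add: Re_divide)

lemma cf_weight_pos:
  assumes "\<And>b. b \<in> set bs \<Longrightarrow> Re b \<ge> 1" and "Re z \<ge> 0"
  shows "cf_weight s bs z > 0"
  using assms
proof (induction bs arbitrary: z)
  case (Cons b bs)
  then have re: "Re (z + b) > 0" by (simp add: add_nonneg_pos order.strict_trans2[of 0 1])
  then have "z + b \<noteq> 0" by (metis less_irrefl zero_complex.simps(1))
  moreover have "Re (1 / (z + b)) \<ge> 0" using re by (intro Re_inverse_nonneg) simp
  ultimately show ?case using Cons by (simp del: plus_complex.simps)
qed simp

text \<open>The derivative of a Moebius map is a constant over the square of one affine function, so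
  the product of factors collapses. In the induction (z + b) (1/(z + b) + \<beta>) = \<beta> (z + b
  + 1/\<beta>), and 1/\<beta> has non-negative real part, which keeps the real part of the new shift
  at least 1.\<close>

lemma cf_weight_eq:
  assumes "\<And>b. b \<in> set bs \<Longrightarrow> Re b \<ge> 1" and "bs \<noteq> []"
  shows "\<exists>K \<beta>. K > 0 \<and> Re \<beta> \<ge> 1 \<and>
           (\<forall>z. Re z \<ge> 0 \<longrightarrow> cf_weight s bs z = K * norm (z + \<beta>) powr (- (2 * s)))"
  using assms
proof (induction bs)
  case (Cons b bs)
  have b: "Re b \<ge> 1" using Cons.prems by simp
  show ?case
  proof (cases "bs = []")
    case True
    with b show ?thesis by (intro exI[of _ 1] exI[of _ b]) simp
  next
    case False
    then obtain K \<beta> where K: "K > 0" and \<beta>: "Re \<beta> \<ge> 1"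
      and eq: "\<And>z. Re z \<ge> 0 \<Longrightarrow> cf_weight s bs z = K * norm (z + \<beta>) powr (- (2 * s))"
      using Cons by auto
    have \<beta>0: "\<beta> \<noteq> 0" using \<beta> by auto
    define \<beta>' where "\<beta>' = b + 1 / \<beta>"
    have \<beta>': "Re \<beta>' \<ge> 1"
      using b Re_inverse_nonneg[of \<beta>] \<beta> by (simp add: \<beta>'_def)
    have "cf_weight s (b # bs) z = (K * norm \<beta> powr (- (2 * s))) * norm (z + \<beta>') powr (- (2 * s))"
      if z: "Re z \<ge> 0" for z
    proof -
      have re: "Re (z + b) > 0" using z b by simp
      then have zb: "z + b \<noteq> 0" by (metis less_irrefl zero_complex.simps(1))
      have "Re (1 / (z + b)) \<ge> 0" using re by (intro Re_inverse_nonneg) simp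
      then have "cf_weight s (b # bs) z =
          K * (norm (z + b) * norm (1 / (z + b) + \<beta>)) powr (- (2 * s))"
        by (simp add: eq powr_mult)
      also have "norm (z + b) * norm (1 / (z + b) + \<beta>) = norm ((z + b) * (1 / (z + b) + \<beta>))"
        by (simp add: norm_mult)
      also have "(z + b) * (1 / (z + b) + \<beta>) = \<beta> * (z + \<beta>')"
        using zb \<beta>0 by (simp add: \<beta>'_def field_simps)
      finally show ?thesis by (simp add: norm_mult powr_mult)
    qed
    moreover have "K * norm \<beta> powr (- (2 * s)) > 0" using K \<beta>0 by simp
    ultimately show ?thesis using \<beta>' by blast
  qed
qed simp

section \<open>Comparison of weights at w and at 0\<close>

text \<open>The derivative 2t / (a^2 + t^2) is at most 1 in modulus, because 2 |t| <= 1 + t^2 and a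
  >= 1.\<close>

lemma ln_add_square_lipschitz:
  fixes a x y :: real
  assumes "a \<ge> 1"
  shows "\<bar>ln (a\<^sup>2 + x\<^sup>2) - ln (a\<^sup>2 + y\<^sup>2)\<bar> \<le> \<bar>x - y\<bar>"
proof -
  have pos: "a\<^sup>2 + t\<^sup>2 > 0" for t using assms by (simp add: add_pos_nonneg)
  have "norm (ln (a\<^sup>2 + x\<^sup>2) - ln (a\<^sup>2 + y\<^sup>2)) \<le> 1 * norm (x - y)"
  proof (rule field_differentiable_bound[of UNIV])
    show "((\<lambda>t. ln (a\<^sup>2 + t\<^sup>2)) has_field_derivative (2 * t / (a\<^sup>2 + t\<^sup>2))) (at t within UNIV)" for t
      using pos[of t] by (auto intro!: derivative_eq_intros)
    fix t :: real
    have "0 \<le> (1 - \<bar>t\<bar>)\<^sup>2" by simp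
    then have "2 * \<bar>t\<bar> \<le> 1 + t\<^sup>2" by (simp add: power2_diff)
    also have "\<dots> \<le> a\<^sup>2 + t\<^sup>2" using assms by simp
    finally show "norm (2 * t / (a\<^sup>2 + t\<^sup>2)) \<le> 1" using pos[of t] by (simp add: abs_mult)
  qed auto
  then show ?thesis by simp
qed

lemma norm_le_exp_norm_add:
  fixes w \<beta> :: complex
  assumes "Re \<beta> \<ge> 1" "Re w \<ge> 0"
  shows "norm \<beta> \<le> exp (norm w / 2) * norm (w + \<beta>)"
proof -
  define a where "a = Re \<beta>"
  have a: "a \<ge> 1" using assms by (simp add: a_def)
  have pos: "a\<^sup>2 + t\<^sup>2 > 0" for t using a by (simp add: add_pos_nonneg)
  have "ln (a\<^sup>2 + (Im \<beta>)\<^sup>2) - ln (a\<^sup>2 + (Im w + Im \<beta>)\<^sup>2) \<le> \<bar>Im w\<bar>"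
    using ln_add_square_lipschitz[OF a, of "Im \<beta>" "Im w + Im \<beta>"] by simp
  also have "\<dots> \<le> norm w" by (rule abs_Im_le_cmod)
  finally have "ln (a\<^sup>2 + (Im \<beta>)\<^sup>2) \<le> norm w + ln (a\<^sup>2 + (Im w + Im \<beta>)\<^sup>2)" by simp
  then have "exp (ln (a\<^sup>2 + (Im \<beta>)\<^sup>2)) \<le> exp (norm w + ln (a\<^sup>2 + (Im w + Im \<beta>)\<^sup>2))" by simp
  then have "a\<^sup>2 + (Im \<beta>)\<^sup>2 \<le> exp (norm w) * (a\<^sup>2 + (Im w + Im \<beta>)\<^sup>2)"
    using pos by (simp add: exp_add)
  also have "\<dots> \<le> exp (norm w) * ((Re w + a)\<^sup>2 + (Im w + Im \<beta>)\<^sup>2)"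
    using a assms by (intro mult_left_mono add_right_mono power_mono) auto
  finally have "(norm \<beta>)\<^sup>2 \<le> (exp (norm w / 2) * norm (w + \<beta>))\<^sup>2"
    by (simp add: cmod_power2 a_def power_mult_distrib flip: exp_double)
  then show ?thesis by (rule power2_le_imp_le) simp
qed

text \<open>The constant K of \<open>cf_weight_eq\<close> cancels, so the factor is the same for all
  words; the exponent is 2s times the 1/2 of \<open>norm_le_exp_norm_add\<close>.\<close>

lemma cf_weight_le:
  assumes "\<And>b. b \<in> set bs \<Longrightarrow> Re b \<ge> 1" and "Re w \<ge> 0" and "s \<ge> 0"
  shows "cf_weight s bs w \<le> exp (s * norm w) * cf_weight s bs 0"
proof (cases "bs = []")
  case True
  then show ?thesis using assms by simp
next
  case False
  obtain K \<beta> where K: "K > 0" and \<beta>: "Re \<beta> \<ge> 1"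
    and eq: "\<And>z. Re z \<ge> 0 \<Longrightarrow> cf_weight s bs z = K * norm (z + \<beta>) powr (- (2 * s))"
    using cf_weight_eq[OF assms(1) False] by metis
  have \<beta>0: "norm \<beta> > 0" using \<beta> by auto
  have "norm \<beta> \<le> exp (norm w / 2) * norm (w + \<beta>)"
    by (rule norm_le_exp_norm_add) (use \<beta> assms in auto)
  then have "(exp (norm w / 2) * norm (w + \<beta>)) powr (- (2 * s)) \<le> norm \<beta> powr (- (2 * s))"
    using \<beta>0 assms by (intro powr_mono2') auto
  moreover have "exp (norm w / 2) powr (- (2 * s)) = inverse (exp (s * norm w))"
    by (simp add: powr_def mult.commute flip: exp_minus)
  ultimately have "inverse (exp (s * norm w)) * norm (w + \<beta>) powr (- (2 * s)) \<le> norm \<beta> powr (- (2 * s))"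
    by (simp add: powr_mult)
  then have "norm (w + \<beta>) powr (- (2 * s)) \<le> exp (s * norm w) * norm \<beta> powr (- (2 * s))"
    by (simp add: field_simps)
  then show ?thesis using K assms by (simp add: eq)
qed

section \<open>Contraction by long words\<close>

text \<open>Factor 1 + bw as b (w + 1/b). If |b| >= 2 the first factor suffices; otherwise Re (1/b)
  = Re b / |b|^2 >= 1/4 pushes the second one up to 5/4. Any constant above 1 would serve the
  contraction.\<close>

lemma norm_one_add_mult_ge:
  fixes b w :: complex
  assumes "Re b \<ge> 1" "Re w \<ge> 1"
  shows "norm (1 + b * w) \<ge> 5 / 4"
proof -
  have b0: "b \<noteq> 0" using assms by auto
  have eq: "norm (1 + b * w) = norm b * norm (w + 1 / b)"
    using b0 by (simp add: distrib_left add.commute flip: norm_mult)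
  have re: "Re (1 / b) = Re b / (norm b)\<^sup>2"
    by (simp add: Re_divide cmod_power2)
  have nb: "norm b \<ge> 1" using assms complex_Re_le_cmod[of b] by linarith
  have nw: "norm (w + 1 / b) \<ge> 1 + Re b / (norm b)\<^sup>2"
    using complex_Re_le_cmod[of "w + 1 / b"] assms re by simp
  show ?thesis
  proof (cases "norm b \<ge> 2")
    case True
    have "Re b / (norm b)\<^sup>2 \<ge> 0" using assms by simp
    then have "norm (w + 1 / b) \<ge> 1" using nw by linarith
    then have "2 * 1 \<le> norm b * norm (w + 1 / b)" using True by (intro mult_mono) auto
    then show ?thesis using eq by simp
  next
    case False
    have "1 / 4 \<le> Re b / (norm b)\<^sup>2"
    proof -
      have "(norm b)\<^sup>2 \<le> 2\<^sup>2" using False by (intro power_mono) auto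
      then have "1 / 4 \<le> 1 / (norm b)\<^sup>2" using nb by (intro divide_left_mono) auto
      also have "\<dots> \<le> Re b / (norm b)\<^sup>2" using assms by (intro divide_right_mono) auto
      finally show ?thesis .
    qed
    then have "5 / 4 \<le> norm (w + 1 / b)" using nw by linarith
    then have "1 * (5 / 4) \<le> norm b * norm (w + 1 / b)" using nb by (intro mult_mono) auto
    then show ?thesis using eq by simp
  qed
qed

text \<open>A single step need not contract strictly: for b = 1 the derivative at 0 has modulus 1.
  After two steps the difference is z - w over two denominators of modulus at least 5/4, hence the
  factor (4/5)^2.\<close>

lemma cf_two_step_contraction:
  assumes "Re b \<ge> 1" "Re c \<ge> 1" "Re z \<ge> 0" "Re w \<ge> 0"
  shows "norm (1 / (1 / (z + b) + c) - 1 / (1 / (w + b) + c)) \<le> (16 / 25) * norm (z - w)"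
proof -
  have 1: "norm (1 + c * (z + b)) \<ge> 5 / 4" and 2: "norm (1 + c * (w + b)) \<ge> 5 / 4"
    using assms by (simp_all only: norm_one_add_mult_ge plus_complex.simps add_increasing)
  have nz: "1 + c * (z + b) \<noteq> 0" "1 + c * (w + b) \<noteq> 0" using 1 2 by auto
  have "Re (z + b) > 0" "Re (w + b) > 0" using assms by simp_all
  then have nz': "z + b \<noteq> 0" "w + b \<noteq> 0" by (metis less_irrefl zero_complex.simps(1))+
  have step: "1 / (1 / u + c) = u / (1 + c * u)" if "u \<noteq> 0" for u
    using that by (simp add: divide_add_eq_iff)
  have "1 / (1 / (z + b) + c) - 1 / (1 / (w + b) + c) =
      (z - w) / ((1 + c * (z + b)) * (1 + c * (w + b)))"
    unfolding step[OF nz'(1)] step[OF nz'(2)] diff_frac_eq[OF nz]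
    by (simp add: algebra_simps)
  then have "norm (1 / (1 / (z + b) + c) - 1 / (1 / (w + b) + c)) =
      norm (z - w) / (norm (1 + c * (z + b)) * norm (1 + c * (w + b)))"
    by (simp add: norm_divide norm_mult)
  also have "\<dots> \<le> norm (z - w) / (5 / 4 * (5 / 4))"
    using 1 2 by (intro divide_left_mono mult_mono mult_pos_pos) auto
  finally show ?thesis by simp
qed

lemma cf_branch_contraction:
  assumes "length bs = 2 * k" and "\<And>b. b \<in> set bs \<Longrightarrow> Re b \<ge> 1"
    and "Re z \<ge> 0" and "Re w \<ge> 0"
  shows "norm (cf_branch bs z - cf_branch bs w) \<le> (16 / 25) ^ k * norm (z - w)"
  using assms
proof (induction k arbitrary: bs z w)
  case (Suc k)
  obtain b bs' where b: "bs = b # bs'" using Suc.prems(1) by (cases bs) auto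
  obtain c cs where c: "bs' = c # cs" using Suc.prems(1) b by (cases bs') auto
  have len: "length cs = 2 * k" using Suc.prems(1) b c by simp
  have re: "Re b \<ge> 1" "Re c \<ge> 1" using Suc.prems(2) b c by auto
  have nn: "Re (1 / (1 / (u + b) + c)) \<ge> 0" if "Re u \<ge> 0" for u
  proof -
    have "Re (1 / (u + b)) \<ge> 0" using that re by (intro Re_inverse_nonneg) simp
    then show ?thesis using re by (intro Re_inverse_nonneg) simp
  qed
  have "norm (cf_branch bs z - cf_branch bs w) \<le>
      (16 / 25) ^ k * norm (1 / (1 / (z + b) + c) - 1 / (1 / (w + b) + c))"
    unfolding b c cf_branch.simps
    by (rule Suc.IH) (use len nn Suc.prems b c in auto)
  also have "\<dots> \<le> (16 / 25) ^ k * ((16 / 25) * norm (z - w))"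
    using Suc.prems re by (intro mult_left_mono cf_two_step_contraction) auto
  finally show ?case by simp
qed simp

section \<open>Positive eigenfunctions of the transfer operator\<close>

text \<open>The common setting of both alphabets. The bounds on real parts give Re (z + b) >= 1, so
  every branch sends \<open>X\<close> into the disc and hence back into \<open>X\<close>, and the
  operator can be iterated.\<close>

locale cf_eigenfunction =
  fixes X B :: "complex set" and s lam :: real and v :: "complex \<Rightarrow> real"
  assumes compact_X: "compact X"
    and disc_subset: "cball (1/2) (1/2) \<subseteq> X"
    and Re_X: "\<And>z. z \<in> X \<Longrightarrow> Re z \<ge> 0"
    and Re_B: "\<And>b. b \<in> B \<Longrightarrow> Re b \<ge> 1"
    and B_nonempty: "B \<noteq> {}"
    and s_nonneg: "s \<ge> 0"
    and cont_v: "continuous_on X v"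
    and v_pos: "\<And>z. z \<in> X \<Longrightarrow> v z > 0"
    and eigen: "\<And>z. z \<in> X \<Longrightarrow>
      ((\<lambda>b. norm (z + b) powr (- (2 * s)) * v (1 / (z + b))) has_sum (lam * v z)) B"
begin

lemma branch_in_X: "z \<in> X \<Longrightarrow> b \<in> B \<Longrightarrow> 1 / (z + b) \<in> X"
  using disc_subset inverse_mem_disc[of "z + b"] Re_X[of z] Re_B[of b] by auto

lemma cf_branch_in_X: "z \<in> X \<Longrightarrow> set bs \<subseteq> B \<Longrightarrow> cf_branch bs z \<in> X"
  by (induction bs arbitrary: z) (auto intro: branch_in_X)

lemma zero_in_X: "0 \<in> X"
  using disc_subset by (auto simp: dist_norm norm_divide)

text \<open>One term of the eigenvalue equation at 0 is already positive and the others are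
  non-negative. Positivity allows cancelling \<open>lam\<close> from inequalities.\<close>

lemma lam_pos: "lam > 0"
proof -
  obtain b where b: "b \<in> B" using B_nonempty by auto
  have b1: "norm b > 0" using Re_B[OF b] by auto
  have pos: "norm (0 + c) powr (- (2 * s)) * v (1 / (0 + c)) \<ge> 0" if "c \<in> B" for c
    using v_pos[OF branch_in_X[OF zero_in_X that]] by simp
  have "(\<Sum>c\<in>{b}. norm (0 + c) powr (- (2 * s)) * v (1 / (0 + c))) \<le> lam * v 0"
    by (rule finite_sum_le_has_sum[OF eigen[OF zero_in_X]]) (use b pos in auto)
  moreover have "norm (0 + b) powr (- (2 * s)) * v (1 / (0 + b)) > 0"
    using v_pos[OF branch_in_X[OF zero_in_X b]] b1 by simp
  ultimately have "lam * v 0 > 0" by simp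
  then show ?thesis using v_pos[OF zero_in_X] by (simp add: zero_less_mult_iff)
qed

text \<open>The eigenvalue equation at \<open>cf_branch bs z\<close> sums over all one-letter extensions of \<open>bs\<close>, so
  termwise comparison over words of length \<open>k + 1\<close> yields the comparison over words of length \<open>k\<close>.\<close>

lemma le_if_le_on_words:
  assumes "z \<in> X" "w \<in> X"
    and "\<And>bs. set bs \<subseteq> B \<Longrightarrow> length bs = k \<Longrightarrow>
      cf_weight s bs z * v (cf_branch bs z) \<le> C * (cf_weight s bs w * v (cf_branch bs w))"
  shows "v z \<le> C * v w"
  using assms(3)
proof (induction k)
  case 0
  show ?case using 0[of "[]"] by simp
next
  case (Suc k)
  show ?case
  proof (rule Suc.IH)
    fix bs assume bs: "set bs \<subseteq> B" "length bs = k"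
    have hs: "((\<lambda>b. cf_weight s (bs @ [b]) u * v (cf_branch (bs @ [b]) u)) has_sum
        (cf_weight s bs u * (lam * v (cf_branch bs u)))) B" if "u \<in> X" for u
      using has_sum_cmult_right[OF eigen[OF cf_branch_in_X[OF that bs(1)]], of "cf_weight s bs u"]
      by (simp add: cf_weight_snoc cf_branch_snoc mult.assoc)
    have "cf_weight s bs z * (lam * v (cf_branch bs z)) \<le>
        C * (cf_weight s bs w * (lam * v (cf_branch bs w)))"
      by (rule has_sum_mono[OF hs[OF assms(1)] has_sum_cmult_right[OF hs[OF assms(2)]]])
        (rule Suc.prems, use bs in auto)
    then have "lam * (cf_weight s bs z * v (cf_branch bs z)) \<le>
        lam * (C * (cf_weight s bs w * v (cf_branch bs w)))"
      by (simp add: mult_ac)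
    then show "cf_weight s bs z * v (cf_branch bs z) \<le> C * (cf_weight s bs w * v (cf_branch bs w))"
      using lam_pos by simp
  qed
qed

text \<open>Uniform continuity gives an additive error; taking it to be \<epsilon> times the
  positive minimum of v on the compact set turns it into a relative one.\<close>

lemma eigenfunction_ratio_near_one:
  assumes "\<epsilon> > 0"
  obtains \<delta> where "\<delta> > 0"
    "\<And>z w. z \<in> X \<Longrightarrow> w \<in> X \<Longrightarrow> norm (z - w) < \<delta> \<Longrightarrow> v z \<le> (1 + \<epsilon>) * v w"
proof -
  obtain z0 where z0: "z0 \<in> X" "\<And>z. z \<in> X \<Longrightarrow> v z0 \<le> v z"
    using continuous_attains_inf[OF compact_X _ cont_v] zero_in_X by blast
  have "uniformly_continuous_on X v"
    by (rule compact_uniformly_continuous[OF cont_v compact_X])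
  moreover have "\<epsilon> * v z0 > 0" using assms v_pos[OF z0(1)] by simp
  ultimately obtain \<delta> where \<delta>: "\<delta> > 0"
    "\<And>z w. z \<in> X \<Longrightarrow> w \<in> X \<Longrightarrow> dist w z < \<delta> \<Longrightarrow> dist (v w) (v z) < \<epsilon> * v z0"
    unfolding uniformly_continuous_on_def by metis
  have "v z \<le> (1 + \<epsilon>) * v w" if "z \<in> X" "w \<in> X" "norm (z - w) < \<delta>" for z w
  proof -
    have "\<bar>v z - v w\<bar> < \<epsilon> * v z0" using \<delta>(2)[of w z] that by (simp add: dist_norm)
    also have "\<dots> \<le> \<epsilon> * v w" using assms z0(2)[OF that(2)] by simp
    finally show ?thesis by (simp add: algebra_simps)
  qed
  with \<delta>(1) show ?thesis by (rule that)
qed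

theorem eigenfunction_le_exp:
  assumes w: "w \<in> X"
  shows "v w \<le> exp (s * norm w) * v 0"
proof (rule field_le_epsilon)
  fix e :: real assume e: "e > 0"
  \<comment> \<open>The slack factor 1 + e/A is chosen so that the final bound A (1 + e/A) is
    exactly A + e.\<close>
  define A where "A = exp (s * norm w) * v 0"
  have A: "A > 0" using v_pos[OF zero_in_X] by (simp add: A_def)
  obtain \<delta> where \<delta>: "\<delta> > 0"
    "\<And>z w. z \<in> X \<Longrightarrow> w \<in> X \<Longrightarrow> norm (z - w) < \<delta> \<Longrightarrow> v z \<le> (1 + e / A) * v w"
    using eigenfunction_ratio_near_one[of "e / A"] e A by auto
  have "(\<lambda>k. (16 / 25) ^ k * norm (w - 0)) \<longlonglongrightarrow> 0"
    by (intro tendsto_mult_left_zero LIMSEQ_power_zero) simp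
  \<comment> \<open>The contraction rate is the same for all words, so one k brings the images of w
    and 0 within \<delta> under every word of length 2k.\<close>
  then obtain k where k: "(16 / 25) ^ k * norm (w - 0) < \<delta>"
    using order_tendstoD(2)[OF _ \<delta>(1)] eventually_happens'[OF sequentially_bot] by blast
  have "v w \<le> (exp (s * norm w) * (1 + e / A)) * v 0"
  proof (rule le_if_le_on_words[OF w zero_in_X])
    fix bs assume bs: "set bs \<subseteq> B" "length bs = 2 * k"
    have re: "\<And>b. b \<in> set bs \<Longrightarrow> Re b \<ge> 1" using bs Re_B by auto
    have "norm (cf_branch bs w - cf_branch bs 0) < \<delta>"
      using cf_branch_contraction[OF bs(2) re Re_X[OF w] Re_X[OF zero_in_X]] k by linarith
    then have "v (cf_branch bs w) \<le> (1 + e / A) * v (cf_branch bs 0)"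
      using cf_branch_in_X bs w zero_in_X by (intro \<delta>(2)) auto
    moreover have "cf_weight s bs w \<le> exp (s * norm w) * cf_weight s bs 0"
      by (rule cf_weight_le[OF re Re_X[OF w] s_nonneg])
    moreover have "cf_weight s bs 0 > 0" by (rule cf_weight_pos) (use re in auto)
    moreover have "v (cf_branch bs w) > 0" by (intro v_pos cf_branch_in_X w bs)
    ultimately have "cf_weight s bs w * v (cf_branch bs w) \<le>
      (exp (s * norm w) * cf_weight s bs 0) * ((1 + e / A) * v (cf_branch bs 0))"
      by (intro mult_mono) auto
    then show "cf_weight s bs w * v (cf_branch bs w) \<le>
      exp (s * norm w) * (1 + e / A) * (cf_weight s bs 0 * v (cf_branch bs 0))"
      by (simp add: mult_ac)
  qed
  also have "\<dots> = A * (1 + e / A)" by (simp add: A_def)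
  also have "\<dots> = A + e" using A by (simp add: field_simps)
  finally show "v w \<le> exp (s * norm w) * v 0 + e" by (simp add: A_def)
qed

end

section \<open>Lattice sums\<close>

lemma nn_integral_powr_tail:
  assumes s: "s > (0::real)" and x: "x > 0"
  shows "(\<integral>\<^sup>+t. ennreal (2 * s * t powr (- (2 * s) - 1)) * indicator {x..} t \<partial>lborel) = x powr (- (2 * s))"
proof -
  have "(\<integral>\<^sup>+t. ennreal (2 * s * t powr (- (2 * s) - 1)) * indicator {x..} t \<partial>lborel) =
      ennreal (0 - (- (x powr (- (2 * s)))))"
  proof (rule nn_integral_FTC_atLeast[where F = "\<lambda>t. - (t powr (- (2 * s)))" and T = 0])
    show "((\<lambda>t. - (t powr (- (2 * s)))) has_real_derivative (2 * s * t powr (- (2 * s) - 1))) (at t)"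
      if "x \<le> t" for t
      using that x by (auto intro!: derivative_eq_intros)
    have "((\<lambda>t::real. - (t powr (- (2 * s)))) \<longlongrightarrow> - 0) at_top"
      using s by (intro tendsto_minus tendsto_neg_powr filterlim_ident) simp
    then show "((\<lambda>t::real. - (t powr (- (2 * s)))) \<longlongrightarrow> 0) at_top" by simp
  qed (use s in auto)
  then show ?thesis by simp
qed

lemma emeasure_annulus_complex:
  assumes "0 \<le> r" "r \<le> t"
  shows "emeasure lborel {z::complex. r < norm z \<and> norm z \<le> t} = ennreal (pi * (t\<^sup>2 - r\<^sup>2))"
proof -
  have eq: "{z::complex. r < norm z \<and> norm z \<le> t} = cball 0 t - cball 0 r" by auto
  have "emeasure lborel (cball (0::complex) t - cball 0 r) =
      emeasure lborel (cball (0::complex) t) - emeasure lborel (cball (0::complex) r)"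
    using assms by (intro emeasure_Diff) (auto simp: emeasure_cball ennreal_mult_eq_top_iff)
  also have "\<dots> = ennreal (pi * (t\<^sup>2 - r\<^sup>2))"
    using assms by (simp add: emeasure_cball unit_ball_vol_2 ennreal_minus right_diff_distrib)
  finally show ?thesis using eq by simp
qed

text \<open>Layer cake: \<open>norm z powr (-2 s)\<close> is the integral of \<open>2 s t powr (-2 s - 1)\<close> over
  \<open>t \<ge> norm z\<close>, which reduces the planar integral to the areas of annuli.\<close>

lemma nn_integral_norm_powr_exterior:
  assumes s: "s > (1::real)" and r: "r > 0"
  shows "(\<integral>\<^sup>+(z::complex). ennreal (norm z powr (- (2 * s))) * indicator {z. r < norm z} z \<partial>lborel)
      = ennreal (pi / (s - 1) * r powr (2 - 2 * s))"
proof -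
  let ?g = "\<lambda>t. ennreal (2 * s * t powr (- (2 * s) - 1))"
  \<comment> \<open>Antiderivative of the weight 2 s t^(-2s-1) times the annulus area pi (t^2 -
    r^2). It vanishes at infinity since s > 1, and the two terms of -F(r) combine through s/(s-1) -
    1 = 1/(s-1).\<close>
  let ?F = "\<lambda>t. - (pi * s / (s - 1)) * t powr (2 - 2 * s) + pi * r\<^sup>2 * t powr (- (2 * s))"
  let ?A = "{p :: real \<times> complex. r < norm (snd p) \<and> norm (snd p) \<le> fst p}"
  have "{p \<in> space (lborel \<Otimes>\<^sub>M lborel). r < norm (snd p :: complex) \<and> norm (snd p) \<le> (fst p :: real)}
      \<in> sets (lborel \<Otimes>\<^sub>M lborel)"
    by measurable
  then have A: "?A \<in> sets (lborel \<Otimes>\<^sub>M lborel)" by (simp add: space_pair_measure)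
  have "(\<integral>\<^sup>+(z::complex). ennreal (norm z powr (- (2 * s))) * indicator {z. r < norm z} z \<partial>lborel) =
      (\<integral>\<^sup>+(z::complex). (\<integral>\<^sup>+t. ?g t * indicator ?A (t, z) \<partial>lborel) \<partial>lborel)"
  proof (rule nn_integral_cong)
    fix z :: complex
    show "ennreal (norm z powr (- (2 * s))) * indicator {z. r < norm z} z =
        (\<integral>\<^sup>+t. ?g t * indicator ?A (t, z) \<partial>lborel)"
    proof (cases "r < norm z")
      case True
      have "(\<integral>\<^sup>+t. ?g t * indicator ?A (t, z) \<partial>lborel) = (\<integral>\<^sup>+t. ?g t * indicator {norm z..} t \<partial>lborel)"
        using True by (intro nn_integral_cong) (auto simp: indicator_def)
      also have "\<dots> = norm z powr (- (2 * s))"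
        using True r s by (intro nn_integral_powr_tail) auto
      finally show ?thesis using True by simp
    next
      case False
      then show ?thesis by simp
    qed
  qed
  also have "\<dots> = (\<integral>\<^sup>+t. (\<integral>\<^sup>+(z::complex). ?g t * indicator ?A (t, z) \<partial>lborel) \<partial>lborel)"
  proof (rule lborel_pair.Fubini')
    have "(\<lambda>p. ?g (fst p) * indicator ?A p) \<in> borel_measurable (lborel \<Otimes>\<^sub>M lborel)"
      by (intro borel_measurable_times_ennreal borel_measurable_indicator A) measurable
    then show "(\<lambda>(t, z). ?g t * indicator ?A (t, z)) \<in> borel_measurable (lborel \<Otimes>\<^sub>M lborel)"
      by (simp add: case_prod_beta)
  qed
  also have "\<dots> = (\<integral>\<^sup>+t. ennreal (2 * s * t powr (- (2 * s) - 1) * (pi * (t\<^sup>2 - r\<^sup>2))) * indicator {r..} t \<partial>lborel)"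
  proof (rule nn_integral_cong)
    fix t :: real
    have "(\<integral>\<^sup>+(z::complex). ?g t * indicator ?A (t, z) \<partial>lborel) =
        (\<integral>\<^sup>+(z::complex). ?g t * indicator {z. r < norm z \<and> norm z \<le> t} z \<partial>lborel)"
      by (intro nn_integral_cong) (auto simp: indicator_def)
    also have "\<dots> = ?g t * emeasure lborel {z::complex. r < norm z \<and> norm z \<le> t}"
      by (rule nn_integral_cmult_indicator) measurable
    also have "\<dots> = ennreal (2 * s * t powr (- (2 * s) - 1) * (pi * (t\<^sup>2 - r\<^sup>2))) * indicator {r..} t"
    proof (cases "r \<le> t")
      case True
      then show ?thesis using r s by (simp add: emeasure_annulus_complex ennreal_mult')
    next
      case False
      then have empty: "{z::complex. r < norm z \<and> norm z \<le> t} = {}" by auto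
      show ?thesis unfolding empty using False by simp
    qed
    finally show "(\<integral>\<^sup>+(z::complex). ?g t * indicator ?A (t, z) \<partial>lborel) = \<dots>" .
  qed
  also have "\<dots> = ennreal (0 - ?F r)"
  proof (rule nn_integral_FTC_atLeast[where F = ?F and T = 0])
    fix t :: real assume t: "r \<le> t"
    have t0: "t > 0" using t r by simp
    have p: "t powr (1 - 2 * s) = t\<^sup>2 * t powr (- (2 * s) - 1)"
      using t0 by (simp flip: powr_numeral powr_add)
    have "(?F has_real_derivative
        (- (pi * s / (s - 1)) * ((2 - 2 * s) * t powr (1 - 2 * s)) + pi * r\<^sup>2 * (- (2 * s) * t powr (- (2 * s) - 1)))) (at t)"
      using t0 s by (auto intro!: derivative_eq_intros)
    also have "- (pi * s / (s - 1)) * ((2 - 2 * s) * t powr (1 - 2 * s)) = 2 * pi * s * t powr (1 - 2 * s)"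
      using s by (simp add: field_simps)
    also have "2 * pi * s * t powr (1 - 2 * s) + pi * r\<^sup>2 * (- (2 * s) * t powr (- (2 * s) - 1)) =
       2 * s * t powr (- (2 * s) - 1) * (pi * (t\<^sup>2 - r\<^sup>2))"
      unfolding p by (simp add: algebra_simps)
    finally show "(?F has_real_derivative
        2 * s * t powr (- (2 * s) - 1) * (pi * (t\<^sup>2 - r\<^sup>2))) (at t)" .
    show "0 \<le> 2 * s * t powr (- (2 * s) - 1) * (pi * (t\<^sup>2 - r\<^sup>2))"
      using t r s by simp
  next
    have "(?F \<longlongrightarrow>
        - (pi * s / (s - 1)) * 0 + pi * r\<^sup>2 * 0) at_top"
      using s by (intro tendsto_add tendsto_mult tendsto_const tendsto_neg_powr filterlim_ident) auto
    then show "(?F \<longlongrightarrow> 0) at_top"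
      by simp
  qed measurable
  also have "0 - ?F r =
      pi / (s - 1) * r powr (2 - 2 * s)"
  proof -
    have "r\<^sup>2 * r powr (- (2 * s)) = r powr (2 - 2 * s)"
      using r by (simp flip: powr_numeral powr_add)
    then show ?thesis using s by (simp add: field_simps)
  qed
  finally show ?thesis .
qed

section \<open>Comparison of off-axis lattice sums with the planar integral\<close>

text \<open>The open unit square with corner \<open>b\<close> that points towards the origin.\<close>

definition inward_square :: "complex \<Rightarrow> complex set" where
  "inward_square b =
     (let c = b - Complex (sgn (Re b)) (sgn (Im b)) / 2
      in box (c - Complex (1/2) (1/2)) (c + Complex (1/2) (1/2)))"

lemma emeasure_inward_square: "emeasure lborel (inward_square b) = 1"
  unfolding inward_square_def Let_def
  by (subst emeasure_lborel_box) (auto simp: Basis_complex_def inner_complex_def)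

lemma inward_square_sets [measurable]: "inward_square b \<in> sets borel"
  by (simp add: inward_square_def Let_def)

text \<open>The interval is (p - 1, p) for positive p and (p, p + 1) for negative p, so rounding x
  away from zero recovers p.\<close>

lemma int_coordinate_inward:
  fixes p x :: real
  assumes "p \<in> \<int>" "p \<noteq> 0" and "p - sgn p / 2 - 1 / 2 < x" "x < p - sgn p / 2 + 1 / 2"
  shows "p = (if x > 0 then of_int \<lceil>x\<rceil> else of_int \<lfloor>x\<rfloor>)" and "\<bar>x\<bar> \<le> \<bar>p\<bar>"
    and "\<bar>p - x\<bar> < 1"
proof -
  obtain k where k: "p = of_int k" using assms(1) by (auto elim: Ints_cases)
  consider "k \<ge> 1" | "k \<le> -1" using assms(2) k by force
  then have "p = (if x > 0 then of_int \<lceil>x\<rceil> else of_int \<lfloor>x\<rfloor>) \<and> \<bar>x\<bar> \<le> \<bar>p\<bar> \<and> \<bar>p - x\<bar> < 1"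
  proof cases
    case 1
    then have r: "real_of_int k \<ge> 1" by simp
    then have "x > real_of_int k - 1" "x < real_of_int k" using assms k by auto
    moreover from this have "\<lceil>x\<rceil> = k" by (intro ceiling_unique) auto
    ultimately show ?thesis using r k by auto
  next
    case 2
    then have r: "real_of_int k \<le> -1" by simp
    then have "x > real_of_int k" "x < real_of_int k + 1" using assms k by auto
    moreover from this have "\<lfloor>x\<rfloor> = k" by (intro floor_unique) auto
    ultimately show ?thesis using r k by auto
  qed
  then show "p = (if x > 0 then of_int \<lceil>x\<rceil> else of_int \<lfloor>x\<rfloor>)" and "\<bar>x\<bar> \<le> \<bar>p\<bar>"
    and "\<bar>p - x\<bar> < 1" by auto
qed

text \<open>For a point on an axis one \<open>sgn\<close> vanishes, and its inward square would
  straddle that axis and overlap its neighbours. Off the axes each square stays within one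
  quadrant.\<close>

definition off_axis_lattice :: "complex set" where
  "off_axis_lattice = {b. Re b \<in> \<int> \<and> Im b \<in> \<int> \<and> Re b \<noteq> 0 \<and> Im b \<noteq> 0}"

text \<open>The last claim recovers b from z, so squares of distinct lattice points are disjoint.
  The constant \<open>sqrt 2\<close> is the diagonal of a square.\<close>

lemma inward_square_bounds:
  assumes "b \<in> off_axis_lattice" "z \<in> inward_square b"
  shows "norm z \<le> norm b" and "norm b < norm z + sqrt 2"
    and "b = Complex (if Re z > 0 then of_int \<lceil>Re z\<rceil> else of_int \<lfloor>Re z\<rfloor>)
                     (if Im z > 0 then of_int \<lceil>Im z\<rceil> else of_int \<lfloor>Im z\<rfloor>)"
proof -
  have re: "Re b \<in> \<int>" "Re b \<noteq> 0" "Re b - sgn (Re b) / 2 - 1 / 2 < Re z" "Re z < Re b - sgn (Re b) / 2 + 1 / 2"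
    and im: "Im b \<in> \<int>" "Im b \<noteq> 0" "Im b - sgn (Im b) / 2 - 1 / 2 < Im z" "Im z < Im b - sgn (Im b) / 2 + 1 / 2"
    using assms by (auto simp: off_axis_lattice_def inward_square_def Let_def in_box_complex_iff)
  note R = int_coordinate_inward[OF re] and I = int_coordinate_inward[OF im]
  show "norm z \<le> norm b"
    unfolding cmod_def using R(2) I(2) by (intro real_sqrt_le_mono add_mono) (simp_all add: abs_le_square_iff)
  have "norm (b - z) < sqrt 2"
  proof -
    have "(Re b - Re z)\<^sup>2 < 1" "(Im b - Im z)\<^sup>2 < 1"
      using R(3) I(3) by (simp_all add: abs_square_less_1)
    then show ?thesis by (simp add: cmod_def)
  qed
  then show "norm b < norm z + sqrt 2" using norm_triangle_ineq2[of b z] by linarith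
  show "b = Complex (if Re z > 0 then of_int \<lceil>Re z\<rceil> else of_int \<lfloor>Re z\<rfloor>)
                     (if Im z > 0 then of_int \<lceil>Im z\<rceil> else of_int \<lfloor>Im z\<rfloor>)"
    using R(1) I(1) by (simp add: complex_eq_iff)
qed

text \<open>Each term is the integral of a constant over a square of area 1. The squares are
  disjoint and lie outside the disc of radius R - sqrt 2, and on the square of b the integrand
  \<open>norm z powr (- (2 * s))\<close> is at least the constant because |z| <= |b|.\<close>

lemma sum_off_axis_lattice_le:
  assumes F: "finite F" "F \<subseteq> off_axis_lattice" "\<And>b. b \<in> F \<Longrightarrow> norm b > R"
    and s: "s > (1::real)" and R: "R > 2"
  shows "(\<Sum>b\<in>F. norm b powr (- (2 * s))) \<le> pi / (s - 1) * (R - sqrt 2) powr (2 - 2 * s)"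
proof -
  have r: "R - sqrt 2 > 0" using R real_sqrt_less_mono[of 2 4] by simp
  have "ennreal (\<Sum>b\<in>F. norm b powr (- (2 * s))) = (\<Sum>b\<in>F. ennreal (norm b powr (- (2 * s))))"
    by (simp add: sum_ennreal)
  also have "\<dots> = (\<Sum>b\<in>F. \<integral>\<^sup>+z. ennreal (norm b powr (- (2 * s))) * indicator (inward_square b) z \<partial>lborel)"
    by (intro sum.cong refl) (simp add: nn_integral_cmult_indicator emeasure_inward_square)
  also have "\<dots> = (\<integral>\<^sup>+z. (\<Sum>b\<in>F. ennreal (norm b powr (- (2 * s))) * indicator (inward_square b) z) \<partial>lborel)"
    by (rule nn_integral_sum[symmetric]) measurable
  also have "\<dots> \<le> (\<integral>\<^sup>+(z::complex). ennreal (norm z powr (- (2 * s))) * indicator {z. R - sqrt 2 < norm z} z \<partial>lborel)"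
  proof (rule nn_integral_mono)
    fix z :: complex
    show "(\<Sum>b\<in>F. ennreal (norm b powr (- (2 * s))) * indicator (inward_square b) z)
        \<le> ennreal (norm z powr (- (2 * s))) * indicator {z. R - sqrt 2 < norm z} z"
    proof (cases "\<exists>b\<in>F. z \<in> inward_square b")
      case True
      then obtain b where b: "b \<in> F" "z \<in> inward_square b" by auto
      have uniq: "z \<notin> inward_square c" if "c \<in> F - {b}" for c
      proof
        assume "z \<in> inward_square c"
        then have "c = b"
          using inward_square_bounds(3)[of c z] inward_square_bounds(3)[of b z] b F(2) that by auto
        then show False using that by simp
      qed
      have bd: "norm z \<le> norm b" "norm b < norm z + sqrt 2"
        using inward_square_bounds(1,2)[of b z] b F(2) by auto
      then have nz: "R - sqrt 2 < norm z" using F(3)[OF b(1)] by linarith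
      have "(\<Sum>c\<in>F. ennreal (norm c powr (- (2 * s))) * indicator (inward_square c) z)
          = ennreal (norm b powr (- (2 * s)))"
        using F(1) b uniq by (subst sum.remove[OF F(1) b(1)]) (simp add: sum.neutral)
      also have "\<dots> \<le> ennreal (norm z powr (- (2 * s)))"
        using bd nz r s by (intro ennreal_leI powr_mono2') auto
      finally show ?thesis using nz by simp
    next
      case False
      then show ?thesis by (simp add: sum.neutral)
    qed
  qed
  also have "\<dots> = ennreal (pi / (s - 1) * (R - sqrt 2) powr (2 - 2 * s))"
    by (rule nn_integral_norm_powr_exterior[OF s r])
  finally show ?thesis using s by (simp add: ennreal_le_iff)
qed

text \<open>By symmetry: \<open>F\<close> and its negative are disjoint with equal sums, so the
  full-plane bound is halved.\<close>

lemma sum_right_half_lattice_le: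
  assumes F: "finite F" "F \<subseteq> off_axis_lattice" "\<And>b. b \<in> F \<Longrightarrow> norm b > R \<and> Re b > 0"
    and s: "s > (1::real)" and R: "R > 2"
  shows "(\<Sum>b\<in>F. norm b powr (- (2 * s))) \<le> pi / 2 * (1 / (s - 1)) * (R - sqrt 2) powr (2 - 2 * s)"
proof -
  have "(\<Sum>b\<in>F \<union> uminus ` F. norm b powr (- (2 * s))) \<le> pi / (s - 1) * (R - sqrt 2) powr (2 - 2 * s)"
    using F s R by (intro sum_off_axis_lattice_le) (auto simp: off_axis_lattice_def)
  also have "(\<Sum>b\<in>F \<union> uminus ` F. norm b powr (- (2 * s))) = 2 * (\<Sum>b\<in>F. norm b powr (- (2 * s)))"
  proof (subst sum.union_disjoint)
    show "F \<inter> uminus ` F = {}" by (auto dest!: F(3))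
  qed (use F in \<open>auto simp: sum.reindex\<close>)
  finally show ?thesis using s by (simp add: field_simps)
qed

text \<open>Halving once more, now by complex conjugation.\<close>

lemma sum_quadrant_lattice_le:
  assumes F: "finite F" "F \<subseteq> off_axis_lattice" "\<And>b. b \<in> F \<Longrightarrow> norm b > R \<and> Re b > 0 \<and> Im b < 0"
    and s: "s > (1::real)" and R: "R > 2"
  shows "(\<Sum>b\<in>F. norm b powr (- (2 * s))) \<le> pi / 4 * (1 / (s - 1)) * (R - sqrt 2) powr (2 - 2 * s)"
proof -
  have "(\<Sum>b\<in>F \<union> cnj ` F. norm b powr (- (2 * s))) \<le> pi / 2 * (1 / (s - 1)) * (R - sqrt 2) powr (2 - 2 * s)"
    using F s R by (intro sum_right_half_lattice_le) (auto simp: off_axis_lattice_def)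
  also have "(\<Sum>b\<in>F \<union> cnj ` F. norm b powr (- (2 * s))) = 2 * (\<Sum>b\<in>F. norm b powr (- (2 * s)))"
  proof (subst sum.union_disjoint)
    show "F \<inter> cnj ` F = {}" by (auto dest!: F(3))
  qed (use F in \<open>auto simp: sum.reindex inj_on_def\<close>)
  finally show ?thesis using s by (simp add: field_simps)
qed

section \<open>The one-dimensional sum along the real axis\<close>

text \<open>The right side is the integral of x^(-p) over [t - 1, t]; by the mean value theorem it
  equals x^(-p) for some x < t.\<close>

lemma powr_le_antiderivative_diff:
  fixes t p :: real
  assumes t: "t > 1" and p: "p > 1"
  shows "t powr (- p) \<le> (t - 1) powr (1 - p) / (p - 1) - t powr (1 - p) / (p - 1)"
proof -
  have "\<exists>x>t - 1. x < t \<and> t powr (1 - p) / (p - 1) - (t - 1) powr (1 - p) / (p - 1) =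
      (t - (t - 1)) * (- (x powr (- p)))"
  proof (rule MVT2)
    fix x assume x: "t - 1 \<le> x" "x \<le> t"
    then have "((\<lambda>x. x powr (1 - p) / (p - 1)) has_real_derivative
        ((1 - p) * x powr (- p)) / (p - 1)) (at x)"
      using t p by (auto intro!: derivative_eq_intros)
    also have "((1 - p) * x powr (- p)) / (p - 1) = - (x powr (- p))"
      using p by (simp add: divide_eq_eq algebra_simps)
    finally show "((\<lambda>x. x powr (1 - p) / (p - 1)) has_real_derivative - (x powr (- p))) (at x)" .
  qed simp
  then obtain x where x: "t - 1 < x" "x < t"
    "(t - 1) powr (1 - p) / (p - 1) - t powr (1 - p) / (p - 1) = x powr (- p)" by auto
  then show ?thesis using t p by (auto intro!: powr_mono2')
qed

lemma sum_nat_powr_tail_le: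
  fixes p R :: real
  assumes F: "finite F" "\<And>m. m \<in> F \<Longrightarrow> real m > R" and p: "p > 1" and R: "R > 1"
  shows "(\<Sum>m\<in>F. real m powr (- p)) \<le> (R - 1) powr (1 - p) / (p - 1)"
proof -
  define G where "G t = t powr (1 - p) / (p - 1)" for t :: real
  \<comment> \<open>The least integer above R. As N - 1 > R - 1 > 0, the telescoped value at N - 1
    is at most the one at R - 1. In \<open>M\<close> the inserted 0 covers empty \<open>F\<close>,
    and the maximum with \<open>N\<close> keeps the telescoping range valid.\<close>
  define N where "N = nat \<lfloor>R\<rfloor> + 1"
  define M where "M = max N (Suc (Max (insert 0 F)))"
  have N: "R < real N" "real N \<le> R + 1" using R by (auto simp: N_def) linarith+
  have sub: "F \<subseteq> {N..<M}"
  proof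
    fix m assume m: "m \<in> F"
    have "real m > R" using F(2) m .
    then have "m \<ge> N" using R by (auto simp: N_def) linarith
    moreover have "m < M" using F(1) m by (auto simp: M_def less_max_iff_disj less_Suc_eq_le)
    ultimately show "m \<in> {N..<M}" by simp
  qed
  have "(\<Sum>m\<in>F. real m powr (- p)) \<le> (\<Sum>m=N..<M. real m powr (- p))"
    using sub by (intro sum_mono2) auto
  also have "\<dots> \<le> (\<Sum>m=N..<M. - G (real (Suc m) - 1) - - G (real m - 1))"
  proof (rule sum_mono)
    fix m assume "m \<in> {N..<M}"
    then have "real m > 1" using N R by auto
    then show "real m powr (- p) \<le> - G (real (Suc m) - 1) - - G (real m - 1)"
      using powr_le_antiderivative_diff[of "real m" p] p by (simp add: G_def)
  qed
  also have "\<dots> = - G (real M - 1) - - G (real N - 1)"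
    by (rule sum_Suc_diff') (simp add: M_def)
  also have "\<dots> \<le> G (real N - 1)" using p by (simp add: G_def)
  also have "\<dots> \<le> G (R - 1)"
    unfolding G_def using N R p by (intro divide_right_mono powr_mono2') auto
  finally show ?thesis by (simp add: G_def)
qed

section \<open>The tail estimate\<close>

lemma I1_D:
  assumes "b \<in> I1"
  shows "Re b \<in> \<int>" "Im b \<in> \<int>" "Re b \<ge> 1"
  using assms by (auto simp: I1_def)

lemma I2_subset_I1: "I2 \<subseteq> I1"
  unfolding I1_def I2_def by blast

lemma I2_subset_off_axis: "I2 \<subseteq> off_axis_lattice"
  by (auto simp: I2_def off_axis_lattice_def)

lemma Im_neg_I2: "b \<in> I2 \<Longrightarrow> Im b < 0"
  by (auto simp: I2_def)

text \<open>The real letters are positive integers and fall under the one-dimensional bound with p =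
  2s; the others lie in the right half of the off-axis lattice.\<close>

lemma sum_I1_tail_le:
  assumes F: "finite F" "F \<subseteq> {b\<in>I1. norm b > R}" and s: "s > (1::real)" and R: "R > 2"
  shows "(\<Sum>b\<in>F. norm b powr (- (2 * s))) \<le>
    1 / (2 * s - 1) * (R - 1) powr (1 - 2 * s) + pi / 2 * (1 / (s - 1)) * (R - sqrt 2) powr (2 - 2 * s)"
proof -
  define M where "M = {m::nat. of_nat m \<in> F}"
  have inj: "inj_on (of_nat :: nat \<Rightarrow> complex) M" by (simp add: inj_on_def)
  have img: "{b\<in>F. Im b = 0} = of_nat ` M"
  proof
    show "{b\<in>F. Im b = 0} \<subseteq> of_nat ` M"
    proof
      fix b assume b: "b \<in> {b\<in>F. Im b = 0}"
      then have "b \<in> I1" using F(2) by auto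
      then obtain m n where "b = of_nat m + of_int n * \<i>" by (auto simp: I1_def)
      then have "b = of_nat m" using b by simp
      then show "b \<in> of_nat ` M" using b by (simp add: M_def)
    qed
  qed (auto simp: M_def)
  have "finite ((of_nat :: nat \<Rightarrow> complex) ` M)"
    using F(1) by (simp flip: img)
  then have finM: "finite M" using inj by (rule finite_imageD)
  have "(\<Sum>b\<in>{b\<in>F. Im b = 0}. norm b powr (- (2 * s))) = (\<Sum>m\<in>M. real m powr (- (2 * s)))"
    unfolding img by (simp add: sum.reindex[OF inj])
  also have "\<dots> \<le> (R - 1) powr (1 - 2 * s) / (2 * s - 1)"
    using finM F(2) s R by (intro sum_nat_powr_tail_le) (auto simp: M_def)
  finally have on: "(\<Sum>b\<in>{b\<in>F. Im b = 0}. norm b powr (- (2 * s))) \<le>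
      1 / (2 * s - 1) * (R - 1) powr (1 - 2 * s)" by simp
  have off: "(\<Sum>b\<in>{b\<in>F. Im b \<noteq> 0}. norm b powr (- (2 * s))) \<le>
      pi / 2 * (1 / (s - 1)) * (R - sqrt 2) powr (2 - 2 * s)"
  proof (rule sum_right_half_lattice_le[OF _ _ _ s R])
    show "{b\<in>F. Im b \<noteq> 0} \<subseteq> off_axis_lattice"
      using F(2) I1_D by (fastforce simp: off_axis_lattice_def)
    show "norm b > R \<and> Re b > 0" if "b \<in> {b\<in>F. Im b \<noteq> 0}" for b
      using that F(2) I1_D(3)[of b] by auto
  qed (use F in auto)
  have "(\<Sum>b\<in>F. norm b powr (- (2 * s))) =
      (\<Sum>b\<in>{b\<in>F. Im b = 0} \<union> {b\<in>F. Im b \<noteq> 0}. norm b powr (- (2 * s)))"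
    by (rule sum.cong) auto
  also have "\<dots> = (\<Sum>b\<in>{b\<in>F. Im b = 0}. norm b powr (- (2 * s))) + (\<Sum>b\<in>{b\<in>F. Im b \<noteq> 0}. norm b powr (- (2 * s)))"
    using F(1) by (intro sum.union_disjoint) auto
  finally show ?thesis using on off by linarith
qed

text \<open>All letters lie strictly inside the fourth quadrant, so there is no contribution from
  the real axis.\<close>

lemma sum_I2_tail_le:
  assumes F: "finite F" "F \<subseteq> {b\<in>I2. norm b > R}" and s: "s > (1::real)" and R: "R > 2"
  shows "(\<Sum>b\<in>F. norm b powr (- (2 * s))) \<le> pi / 4 * (1 / (s - 1)) * (R - sqrt 2) powr (2 - 2 * s)"
proof (rule sum_quadrant_lattice_le[OF F(1) _ _ s R])
  show "F \<subseteq> off_axis_lattice" using F(2) I2_subset_off_axis by auto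
  show "norm b > R \<and> Re b > 0 \<and> Im b < 0" if "b \<in> F" for b
    using that F(2) I1_D(3)[of b] I2_subset_I1 Im_neg_I2[of b] by auto
qed

section \<open>Termwise bounds and their summation\<close>

text \<open>Expand the square: the cross term of the real parts is non-negative, and that of the
  imaginary parts is at least -|b| because |Im z| <= 1/2.\<close>

lemma norm_add_square_ge:
  fixes b z :: complex
  assumes "Re b \<ge> 0" "Re z \<ge> 0" "\<bar>Im z\<bar> \<le> 1 / 2"
  shows "(norm (z + b))\<^sup>2 \<ge> (norm b)\<^sup>2 - norm b"
proof -
  have "\<bar>Im z * Im b\<bar> \<le> 1 / 2 * norm b"
    unfolding abs_mult using assms by (intro mult_mono abs_Im_le_cmod) auto
  moreover have "Re z * Re b \<ge> 0" using assms by simp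
  moreover have "(norm (z + b))\<^sup>2 = (norm b)\<^sup>2 + (Re z)\<^sup>2 + (Im z)\<^sup>2 + 2 * (Re z * Re b) + 2 * (Im z * Im b)"
    unfolding cmod_power2 by (simp add: power2_eq_square algebra_simps)
  moreover have "(Re z)\<^sup>2 \<ge> 0" "(Im z)\<^sup>2 \<ge> 0" by simp_all
  ultimately show ?thesis by linarith
qed

context cf_eigenfunction
begin

text \<open>Both factors come from |z + b|^2 >= |b|^2 - |b|. Bounding the right side below by R^2 -
  R makes 1/(z + b) small, and \<open>eigenfunction_le_exp\<close> yields the exponential; bounding
  it below by |b|^2 (R - 1)/R yields the power of R/(R - 1).\<close>

lemma tail_term_le:
  assumes z: "z \<in> X" "\<bar>Im z\<bar> \<le> 1 / 2" and b: "b \<in> B" "norm b > R" and R: "R > 1"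
  shows "v (1 / (z + b)) / norm (z + b) powr (2 * s) \<le>
    exp (s / sqrt (R\<^sup>2 - R)) * (R / (R - 1)) powr s * v 0 * norm b powr (- (2 * s))"
proof -
  have sq: "(norm b)\<^sup>2 - norm b \<le> (norm (z + b))\<^sup>2"
    using norm_add_square_ge[of b z] Re_B[OF b(1)] Re_X[OF z(1)] z(2) by simp
  have pos: "R\<^sup>2 - R > 0" using R by (simp add: power2_eq_square)
  have "R * (R - 1) \<le> norm b * (norm b - 1)" using b R by (intro mult_mono) auto
  then have "R\<^sup>2 - R \<le> (norm b)\<^sup>2 - norm b" by (simp add: power2_eq_square algebra_simps)
  then have "sqrt (R\<^sup>2 - R) \<le> norm (z + b)" using sq by (intro real_le_lsqrt) auto
  moreover have "sqrt (R\<^sup>2 - R) > 0" using pos by simp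
  ultimately have zb: "norm (z + b) > 0" and "1 / norm (z + b) \<le> 1 / sqrt (R\<^sup>2 - R)"
    by (linarith, intro divide_left_mono mult_pos_pos) auto
  then have "s * norm (1 / (z + b)) \<le> s / sqrt (R\<^sup>2 - R)"
    using mult_left_mono[OF _ s_nonneg, of "1 / norm (z + b)" "1 / sqrt (R\<^sup>2 - R)"] by (simp add: norm_divide)
  then have "exp (s * norm (1 / (z + b))) * v 0 \<le> exp (s / sqrt (R\<^sup>2 - R)) * v 0"
    using v_pos[OF zero_in_X] by (intro mult_right_mono) auto
  then have v: "v (1 / (z + b)) \<le> exp (s / sqrt (R\<^sup>2 - R)) * v 0"
    using eigenfunction_le_exp[OF branch_in_X[OF z(1) b(1)]] by linarith
  have b0: "norm b > 0" using b R by linarith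
  have square_powr: "(a\<^sup>2) powr (- s) = a powr (- (2 * s))" if "a > 0" for a :: real
    using that by (simp add: powr_powr flip: powr_numeral)
  have "norm b * (1 / R) \<ge> 1" using b R by (simp add: field_simps)
  then have "norm b * 1 \<le> norm b * (norm b * (1 / R))" using b0 by (intro mult_left_mono) auto
  then have "(norm b)\<^sup>2 * ((R - 1) / R) \<le> (norm b)\<^sup>2 - norm b"
    using R by (simp add: power2_eq_square field_simps)
  then have "(norm b)\<^sup>2 * ((R - 1) / R) \<le> (norm (z + b))\<^sup>2" using sq by linarith
  then have "((norm (z + b))\<^sup>2) powr (- s) \<le> ((norm b)\<^sup>2 * ((R - 1) / R)) powr (- s)"
    using b0 R s_nonneg by (intro powr_mono2') auto
  also have "\<dots> = norm b powr (- (2 * s)) * ((R - 1) / R) powr (- s)"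
    using square_powr[OF b0] R by (subst powr_mult) auto
  also have "((R - 1) / R) powr (- s) = (R / (R - 1)) powr s"
    using R by (simp add: powr_minus powr_divide)
  also have "((norm (z + b))\<^sup>2) powr (- s) = 1 / norm (z + b) powr (2 * s)"
    using square_powr[OF zb] by (simp add: powr_minus_divide)
  finally have w: "1 / norm (z + b) powr (2 * s) \<le> norm b powr (- (2 * s)) * (R / (R - 1)) powr s" .
  have "v (1 / (z + b)) * (1 / norm (z + b) powr (2 * s)) \<le>
      (exp (s / sqrt (R\<^sup>2 - R)) * v 0) * (norm b powr (- (2 * s)) * (R / (R - 1)) powr s)"
    using v w v_pos[OF zero_in_X] by (intro mult_mono) auto
  then show ?thesis by (simp add: mult_ac)
qed

lemma tail_summable:
  assumes "z \<in> X" "A \<subseteq> B"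
  shows "(\<lambda>b. v (1 / (z + b)) / norm (z + b) powr (2 * s)) summable_on A"
proof -
  have "(\<lambda>b. norm (z + b) powr (- (2 * s)) * v (1 / (z + b))) summable_on A"
    using eigen[OF assms(1)] assms(2) by (blast intro: summable_on_subset_banach has_sum_imp_summable)
  then show ?thesis by (simp add: powr_minus_divide)
qed

lemma tail_infsum_le:
  assumes z: "z \<in> X" "\<bar>Im z\<bar> \<le> 1 / 2" and R: "R > 1"
    and S: "\<And>F. finite F \<Longrightarrow> F \<subseteq> {b\<in>B. norm b > R} \<Longrightarrow> (\<Sum>b\<in>F. norm b powr (- (2 * s))) \<le> S"
  shows "(\<Sum>\<^sub>\<infinity>b\<in>{b\<in>B. norm b > R}. v (1 / (z + b)) / norm (z + b) powr (2 * s)) \<le>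
    exp (s / sqrt (R\<^sup>2 - R)) * (R / (R - 1)) powr s * S * v 0"
proof (rule infsum_le_finite_sums)
  show "(\<lambda>b. v (1 / (z + b)) / norm (z + b) powr (2 * s)) summable_on {b\<in>B. norm b > R}"
    using z by (intro tail_summable) auto
  fix F assume F: "finite F" "F \<subseteq> {b\<in>B. norm b > R}"
  let ?C = "exp (s / sqrt (R\<^sup>2 - R)) * (R / (R - 1)) powr s * v 0"
  have "(\<Sum>b\<in>F. v (1 / (z + b)) / norm (z + b) powr (2 * s)) \<le> (\<Sum>b\<in>F. ?C * norm b powr (- (2 * s)))"
    using F z R by (intro sum_mono tail_term_le) auto
  also have "\<dots> = ?C * (\<Sum>b\<in>F. norm b powr (- (2 * s)))" by (simp add: sum_distrib_left)
  also have "\<dots> \<le> ?C * S"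
    using S[OF F] v_pos[OF zero_in_X] by (intro mult_left_mono) auto
  finally show "(\<Sum>b\<in>F. v (1 / (z + b)) / norm (z + b) powr (2 * s)) \<le>
      exp (s / sqrt (R\<^sup>2 - R)) * (R / (R - 1)) powr s * S * v 0" by (simp add: mult_ac)
qed

end

theorem theorem5p12:
  fixes U :: "complex set" and B :: "complex set" and s R :: real and v :: "complex \<Rightarrow> real"
  assumes "bounded U" and "open U" and "mildly_regular U"
    and "interior (cball (1/2) (1/2)) \<subseteq> U"
    and "\<forall>z\<in>U. Re z > 0"
    and "cball (1/2) (1/2) \<subseteq> closure U"
    and "\<forall>z\<in>closure U. 0 \<le> Re z \<and> Re z \<le> 1 \<and> \<bar>Im z\<bar> \<le> 1/2"
    and "B = I1 \<or> B = I2"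
    and "s > 1" and "R > 2"
    and "continuous_on (closure U) v"
    and "\<forall>z\<in>closure U. v z > 0"
    and "\<exists>lam. \<forall>z\<in>closure U.
           HAS_SUM (\<lambda>b. norm (z + b) powr (- (2 * s)) * v (1 / (z + b))) B (lam * v z)"
  shows "\<forall>z\<in>closure U.
     (B = I1 \<longrightarrow>
        (\<lambda>b. v (1 / (z + b)) / norm (z + b) powr (2 * s)) summable_on {b\<in>I1. norm b > R} \<and>
        (\<Sum>\<^sub>\<infinity>b\<in>{b\<in>I1. norm b > R}. v (1 / (z + b)) / norm (z + b) powr (2 * s))
          \<le> exp (s / sqrt (R^2 - R)) * (R / (R - 1)) powr s *
             (1 / (2 * s - 1) * (1 / (R - 1)) powr (2 * s - 1)
              + pi / 2 * (1 / (s - 1)) * (1 / (R - sqrt 2)) powr (2 * s - 2)) * v 0) \<and>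
     (B = I2 \<longrightarrow>
        (\<lambda>b. v (1 / (z + b)) / norm (z + b) powr (2 * s)) summable_on {b\<in>I2. norm b > R} \<and>
        (\<Sum>\<^sub>\<infinity>b\<in>{b\<in>I2. norm b > R}. v (1 / (z + b)) / norm (z + b) powr (2 * s))
          \<le> exp (s / sqrt (R^2 - R)) * (R / (R - 1)) powr s *
             (pi / 4 * (1 / (s - 1)) * (1 / (R - sqrt 2)) powr (2 * s - 2)) * v 0)"
proof -
  obtain lam where lam: "\<And>z. z \<in> closure U \<Longrightarrow>
      ((\<lambda>b. norm (z + b) powr (- (2 * s)) * v (1 / (z + b))) has_sum (lam * v z)) B"
    using assms(13) by blast
  \<comment> \<open>An element of the smaller alphabet shows that both are non-empty.\<close>
  have "1 - \<i> \<in> I2" unfolding I2_def by (rule CollectI, rule exI[of _ 1], rule exI[of _ "-1"]) simp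
  then have "B \<noteq> {}" using assms(8) I2_subset_I1 by auto
  interpret cf_eigenfunction "closure U" B s lam v
  proof
    show "compact (closure U)" using \<open>bounded U\<close> by (simp add: compact_closure)
    show "Re b \<ge> 1" if "b \<in> B" for b using that assms(8) I2_subset_I1 I1_D(3) by blast
  qed (use assms lam \<open>B \<noteq> {}\<close> in auto)
  have flip: "(1 / a) powr p = a powr (- p)" if "a > 0" for a p :: real
    using that by (simp add: powr_divide powr_minus_divide)
  have "R - sqrt 2 > 0" using \<open>R > 2\<close> real_sqrt_less_mono[of 2 4] by simp
  \<comment> \<open>The target has powers of reciprocals, the lattice bounds have negative
    exponents; the two agree since both bases are positive.\<close>
  then have powr_eq: "(1 / (R - 1)) powr (2 * s - 1) = (R - 1) powr (1 - 2 * s)"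
    "(1 / (R - sqrt 2)) powr (2 * s - 2) = (R - sqrt 2) powr (2 - 2 * s)"
    using \<open>R > 2\<close> by (simp_all add: flip)
  show ?thesis unfolding powr_eq
  proof (intro ballI conjI impI)
    fix z assume z: "z \<in> closure U"
    have Imz: "\<bar>Im z\<bar> \<le> 1 / 2" using assms(7) z by auto
    have R: "R > 1" using \<open>R > 2\<close> by simp
    {
      assume B: "B = I1"
      show "(\<lambda>b. v (1 / (z + b)) / norm (z + b) powr (2 * s)) summable_on {b\<in>I1. norm b > R}"
        by (rule tail_summable[OF z]) (use B in auto)
      show "(\<Sum>\<^sub>\<infinity>b\<in>{b\<in>I1. norm b > R}. v (1 / (z + b)) / norm (z + b) powr (2 * s))
        \<le> exp (s / sqrt (R^2 - R)) * (R / (R - 1)) powr s *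
           (1 / (2 * s - 1) * (R - 1) powr (1 - 2 * s)
            + pi / 2 * (1 / (s - 1)) * (R - sqrt 2) powr (2 - 2 * s)) * v 0"
        by (rule tail_infsum_le[OF z Imz R, unfolded B])
          (rule sum_I1_tail_le[OF _ _ \<open>s > 1\<close> \<open>R > 2\<close>])
    }
    {
      assume B: "B = I2"
      show "(\<lambda>b. v (1 / (z + b)) / norm (z + b) powr (2 * s)) summable_on {b\<in>I2. norm b > R}"
        by (rule tail_summable[OF z]) (use B in auto)
      show "(\<Sum>\<^sub>\<infinity>b\<in>{b\<in>I2. norm b > R}. v (1 / (z + b)) / norm (z + b) powr (2 * s))
        \<le> exp (s / sqrt (R^2 - R)) * (R / (R - 1)) powr s *
           (pi / 4 * (1 / (s - 1)) * (R - sqrt 2) powr (2 - 2 * s)) * v 0"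
        by (rule tail_infsum_le[OF z Imz R, unfolded B])
          (rule sum_I2_tail_le[OF _ _ \<open>s > 1\<close> \<open>R > 2\<close>])
    }
  qed
qed

end
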